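(* Let $A$ and $B$ be two Banach algebras and let $T:B\to A$ be a Banach algebra homomorphism with $\|T\|\leq 1$. If $A\times_TB$ is $\Delta$-weak character amenable, then both $A$ and $B$ are $\Delta$-weak character amenable. Moreover, in the case that $T(B)$ is dense in $A$, the converse is also valid: if both $A$ and $B$ are $\Delta$-weak character amenable, then $A\times_TB$ is $\Delta$-weak character amenable.
   Context: For a Banach algebra $A$, $\Delta(A)$ denotes the set of all nonzero characters (nonzero multiplicative linear functionals) on $A$. For $f\in A^*$ and $a\in A$, the functional $f.a\in A^*$ is defined by $(f.a)(b)=f(ab)$ for $b\in A$. For $\varphi\in\Delta(A)\cup\{0\}$, $A$ is called $\Delta$-weak $\varphi$-amenable if there exists $m\in A^{**}$ such that (1) $m(\varphi)=0$; and (2) $m(\psi.a)=\psi(a)$ for all $a\in A$ and all $\psi\in\Delta(A)\setminus\{\varphi\}$. $A$ is called $\Delta$-weak character amenable if it is $\Delta$-weak $\varphi$-amenable for every $\varphi\in\Delta(A)\cup\{0\}$. For Banach algebras $A,B$ and a Banach algebra homomorphism $T:B\to A$ with $\|T\|\le 1$, $A\times_TB$ denotes the Banach algebra whose underlying space is the cartesian product $A\times B$, with multiplication $(a_1,b_1).(a_2,b_2)=(a_1a_2+a_1T(b_2)+T(b_1)a_2,\,b_1b_2)$ for $a_1,a_2\in A$, $b_1,b_2\in B$, and norm $\|(a,b)\|=\|a\|_A+\|b\|_B$. *)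

theory Defs
  imports "HOL-Analysis.Analysis"
begin

text \<open>
  The multiplication of \<open>A \<times>\<^sub>T B\<close> depends on the map \<open>T\<close>, and its norm differs from the Euclidean one
  that the library puts on product types, so \<open>A \<times>\<^sub>T B\<close> cannot be an instance of the library's type
  classes for normed algebras. Scalar multiplication, multiplication and norm are therefore
  carried by a record; addition comes from the class \<^class>\<open>ab_group_add\<close> and the carrier is the
  whole type. Algebras are complex and need be neither unital nor commutative.
\<close>

record 'a normed_alg =
  scal :: "complex \<Rightarrow> 'a \<Rightarrow> 'a"
  mul :: "'a \<Rightarrow> 'a \<Rightarrow> 'a"
  nrm :: "'a \<Rightarrow> real"

definition alg_dist :: "'a::ab_group_add normed_alg \<Rightarrow> 'a \<Rightarrow> 'a \<Rightarrow> real" where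
  "alg_dist A x y = nrm A (x - y)"

locale banach_algebra = vector_space "scal A" for A :: "'a::ab_group_add normed_alg" +
  assumes mul_assoc: "mul A (mul A x y) z = mul A x (mul A y z)"
    and mul_add_left: "mul A (x + y) z = mul A x z + mul A y z"
    and mul_add_right: "mul A x (y + z) = mul A x y + mul A x z"
    and mul_scal_left: "mul A (scal A c x) y = scal A c (mul A x y)"
    and mul_scal_right: "mul A x (scal A c y) = scal A c (mul A x y)"
    and nrm_nonneg: "0 \<le> nrm A x"
    and nrm_eq_0_iff: "nrm A x = 0 \<longleftrightarrow> x = 0"
    and nrm_triangle: "nrm A (x + y) \<le> nrm A x + nrm A y"
    and nrm_scal: "nrm A (scal A c x) = cmod c * nrm A x"
    and nrm_mul: "nrm A (mul A x y) \<le> nrm A x * nrm A y"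
    and complete: "Metric_space.mcomplete UNIV (alg_dist A)"

definition norm_dense :: "'a::ab_group_add normed_alg \<Rightarrow> 'a set \<Rightarrow> bool" where
  "norm_dense A S \<longleftrightarrow> Metric_space.mtopology UNIV (alg_dist A) closure_of S = UNIV"

definition complex_alg :: "complex normed_alg" where
  "complex_alg = \<lparr>scal = (*), mul = (*), nrm = cmod\<rparr>"

definition linear_map ::
    "'a::ab_group_add normed_alg \<Rightarrow> 'b::ab_group_add normed_alg \<Rightarrow> ('a \<Rightarrow> 'b) \<Rightarrow> bool" where
  "linear_map A B f \<longleftrightarrow> Vector_Spaces.linear (scal A) (scal B) f"

definition bounded_map ::
    "'a::ab_group_add normed_alg \<Rightarrow> 'b::ab_group_add normed_alg \<Rightarrow> ('a \<Rightarrow> 'b) \<Rightarrow> bool" where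
  "bounded_map A B f \<longleftrightarrow> (\<exists>K. \<forall>x. nrm B (f x) \<le> K * nrm A x)"

definition multiplicative_map ::
    "'a::ab_group_add normed_alg \<Rightarrow> 'b::ab_group_add normed_alg \<Rightarrow> ('a \<Rightarrow> 'b) \<Rightarrow> bool" where
  "multiplicative_map A B f \<longleftrightarrow> (\<forall>x y. f (mul A x y) = mul B (f x) (f y))"

definition banach_algebra_hom ::
    "'a::ab_group_add normed_alg \<Rightarrow> 'b::ab_group_add normed_alg \<Rightarrow> ('a \<Rightarrow> 'b) \<Rightarrow> bool" where
  "banach_algebra_hom A B f \<longleftrightarrow> linear_map A B f \<and> bounded_map A B f \<and> multiplicative_map A B f"

text \<open>Meaningful only for maps that are linear and bounded.\<close>

definition op_norm ::
    "'a::ab_group_add normed_alg \<Rightarrow> 'b::ab_group_add normed_alg \<Rightarrow> ('a \<Rightarrow> 'b) \<Rightarrow> real" where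
  "op_norm A B f = (SUP x\<in>{x. nrm A x \<le> 1}. nrm B (f x))"

definition dual :: "'a::ab_group_add normed_alg \<Rightarrow> ('a \<Rightarrow> complex) set" where
  "dual A = {f. linear_map A complex_alg f \<and> bounded_map A complex_alg f}"

text \<open>
  An element of the bidual is represented by any function on \<^typ>\<open>'a \<Rightarrow> complex\<close> whose restriction
  to \<open>dual A\<close> is linear and bounded for the dual norm; its values outside \<open>dual A\<close> are arbitrary.
\<close>

definition bidual :: "'a::ab_group_add normed_alg \<Rightarrow> (('a \<Rightarrow> complex) \<Rightarrow> complex) set" where
  "bidual A = {m.
     (\<forall>f\<in>dual A. \<forall>g\<in>dual A. m (\<lambda>x. f x + g x) = m f + m g) \<and>
     (\<forall>c. \<forall>f\<in>dual A. m (\<lambda>x. c * f x) = c * m f) \<and>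
     (\<exists>K. \<forall>f\<in>dual A. cmod (m f) \<le> K * op_norm A complex_alg f)}"

text \<open>
  Continuity is not part of the definition: characters of a Banach algebra are automatically
  bounded, so \<open>\<Delta> A \<subseteq> dual A\<close>.
\<close>

definition characters :: "'a::ab_group_add normed_alg \<Rightarrow> ('a \<Rightarrow> complex) set" ("\<Delta>") where
  "\<Delta> A = {\<phi>. linear_map A complex_alg \<phi> \<and> multiplicative_map A complex_alg \<phi> \<and> \<phi> \<noteq> (\<lambda>_. 0)}"

text \<open>The functional \<open>f.a\<close>.\<close>

definition dual_act :: "'a normed_alg \<Rightarrow> ('a \<Rightarrow> complex) \<Rightarrow> 'a \<Rightarrow> ('a \<Rightarrow> complex)" where
  "dual_act A f a = (\<lambda>b. f (mul A a b))"

definition delta_weak_amenable_at :: "'a::ab_group_add normed_alg \<Rightarrow> ('a \<Rightarrow> complex) \<Rightarrow> bool" where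
  "delta_weak_amenable_at A \<phi> \<longleftrightarrow>
     (\<exists>m\<in>bidual A. m \<phi> = 0 \<and> (\<forall>a. \<forall>\<psi>\<in>\<Delta> A - {\<phi>}. m (dual_act A \<psi> a) = \<psi> a))"

definition delta_weak_character_amenable :: "'a::ab_group_add normed_alg \<Rightarrow> bool" where
  "delta_weak_character_amenable A \<longleftrightarrow> (\<forall>\<phi> \<in> \<Delta> A \<union> {\<lambda>_. 0}. delta_weak_amenable_at A \<phi>)"

definition lau_product ::
    "'a::ab_group_add normed_alg \<Rightarrow> ('b \<Rightarrow> 'a) \<Rightarrow> 'b::ab_group_add normed_alg \<Rightarrow> ('a \<times> 'b) normed_alg"
    ("_ \<times>\<^bsub>_\<^esub> _" [81, 0, 81] 80) where
  "A \<times>\<^bsub>T\<^esub> B = \<lparr>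
     scal = (\<lambda>c (a, b). (scal A c a, scal B c b)),
     mul = (\<lambda>(a1, b1) (a2, b2). (mul A a1 a2 + mul A a1 (T b2) + mul A (T b1) a2, mul B b1 b2)),
     nrm = (\<lambda>(a, b). nrm A a + nrm B b)\<rparr>"

lemma (in banach_algebra) metric: "Metric_space UNIV (alg_dist A)"
proof
  fix x y z :: 'a
  show "0 \<le> alg_dist A x y" by (simp add: alg_dist_def nrm_nonneg)
  have "nrm A (- u) = nrm A u" for u
    using nrm_scal[of "-1" u] by simp
  from this[of "x - y"] show "alg_dist A x y = alg_dist A y x" by (simp add: alg_dist_def)
  show "(alg_dist A x y = 0) = (x = y)" by (simp add: alg_dist_def nrm_eq_0_iff)
  show "alg_dist A x z \<le> alg_dist A x y + alg_dist A y z"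
    using nrm_triangle[of "x - y" "y - z"] by (simp add: alg_dist_def)
qed

lemma banach_algebra_lau_product:
  assumes A: "banach_algebra A" and B: "banach_algebra B"
    and T: "banach_algebra_hom B A T" and T1: "op_norm B A T \<le> 1"
  shows "banach_algebra (A \<times>\<^bsub>T\<^esub> B)"
proof -
  interpret A: banach_algebra A by fact
  interpret B: banach_algebra B by fact
  interpret T: Vector_Spaces.linear "scal B" "scal A" T
    using T by (simp add: banach_algebra_hom_def linear_map_def)
  have Tm: "T (mul B x y) = mul A (T x) (T y)" for x y
    using T by (simp add: banach_algebra_hom_def multiplicative_map_def)
  obtain K where K: "\<And>x. nrm A (T x) \<le> K * nrm B x"
    using T by (auto simp: banach_algebra_hom_def bounded_map_def)
  have Tle: "nrm A (T b) \<le> nrm B b" for b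
  proof (cases "b = 0")
    case True
    then show ?thesis using K[of b] B.nrm_eq_0_iff[of b] by simp
  next
    case False
    define r where "r = nrm B b"
    have r: "r > 0" using False B.nrm_nonneg[of b] B.nrm_eq_0_iff[of b] by (simp add: r_def)
    define x where "x = scal B (of_real (1 / r)) b"
    have x: "nrm B x \<le> 1" using r by (simp add: x_def B.nrm_scal norm_divide flip: r_def)
    have "nrm A (T y) \<le> \<bar>K\<bar>" if "nrm B y \<le> 1" for y
    proof -
      have "K * nrm B y \<le> \<bar>K\<bar> * 1"
        using that B.nrm_nonneg[of y] by (intro mult_mono) auto
      then show ?thesis using K[of y] by simp
    qed
    then have "bdd_above ((\<lambda>y. nrm A (T y)) ` {y. nrm B y \<le> 1})" by (auto intro!: bdd_aboveI2)
    then have "nrm A (T x) \<le> op_norm B A T" unfolding op_norm_def by (rule cSUP_upper2) (use x in auto)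
    then have "nrm A (T x) \<le> 1" using T1 by simp
    moreover have "nrm A (T x) = nrm A (T b) / r"
      using r by (simp add: x_def T.scale A.nrm_scal norm_divide)
    ultimately show ?thesis using r by (simp add: r_def)
  qed
  let ?P = "A \<times>\<^bsub>T\<^esub> B"
  have vs: "vector_space (scal ?P)"
    by unfold_locales (auto simp: lau_product_def A.scale_right_distrib A.scale_left_distrib
        B.scale_right_distrib B.scale_left_distrib)
  have nrmP: "nrm ?P z = nrm A (fst z) + nrm B (snd z)" for z
    by (simp add: lau_product_def split_beta)
  have tri: "nrm ?P (x + y) \<le> nrm ?P x + nrm ?P y" for x y
    using A.nrm_triangle[of "fst x" "fst y"] B.nrm_triangle[of "snd x" "snd y"] by (simp add: nrmP)
  have hom: "nrm ?P (scal ?P c x) = cmod c * nrm ?P x" for c x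
    by (simp add: lau_product_def split_beta A.nrm_scal B.nrm_scal algebra_simps)
  have zero: "nrm ?P x = 0 \<longleftrightarrow> x = 0" for x
    using A.nrm_nonneg[of "fst x"] B.nrm_nonneg[of "snd x"] A.nrm_eq_0_iff[of "fst x"] B.nrm_eq_0_iff[of "snd x"]
    by (auto simp: nrmP prod_eq_iff add_nonneg_eq_0_iff)
  have distP: "alg_dist ?P z w = alg_dist A (fst z) (fst w) + alg_dist B (snd z) (snd w)" for z w
    by (simp add: alg_dist_def nrmP)
  interpret MA: Metric_space UNIV "alg_dist A" by (rule A.metric)
  interpret MB: Metric_space UNIV "alg_dist B" by (rule B.metric)
  interpret MP: Metric_space UNIV "alg_dist ?P"
  proof
    fix x y z
    show "0 \<le> alg_dist ?P x y" by (simp add: distP)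
    show "alg_dist ?P x y = alg_dist ?P y x" by (simp add: distP MA.commute MB.commute)
    show "(alg_dist ?P x y = 0) = (x = y)" by (simp add: alg_dist_def zero)
    show "alg_dist ?P x z \<le> alg_dist ?P x y + alg_dist ?P y z"
      using tri[of "x - y" "y - z"] by (simp add: alg_dist_def)
  qed
  have comp: "MP.mcomplete"
    unfolding MP.mcomplete_def
  proof (intro allI impI)
    fix \<sigma> :: "nat \<Rightarrow> 'a \<times> 'b" assume "MP.MCauchy \<sigma>"
    then have C: "\<exists>N. \<forall>n n'. N \<le> n \<longrightarrow> N \<le> n' \<longrightarrow> alg_dist ?P (\<sigma> n) (\<sigma> n') < e" if "e > 0" for e
      using that by (auto simp: MP.MCauchy_def)
    have le: "alg_dist A (fst z) (fst w) \<le> alg_dist ?P z w" "alg_dist B (snd z) (snd w) \<le> alg_dist ?P z w" for z w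
      by (simp_all add: distP)
    have "MA.MCauchy (fst \<circ> \<sigma>)" "MB.MCauchy (snd \<circ> \<sigma>)"
      unfolding MA.MCauchy_def MB.MCauchy_def using C le by (simp_all, meson le_less_trans, meson le_less_trans)
    then obtain a b where ab: "limitin MA.mtopology (fst \<circ> \<sigma>) a sequentially"
        "limitin MB.mtopology (snd \<circ> \<sigma>) b sequentially"
      using A.complete B.complete unfolding MA.mcomplete_def MB.mcomplete_def by blast
    have "limitin MP.mtopology \<sigma> (a, b) sequentially"
      unfolding MP.limit_metric_sequentially
    proof (intro conjI allI impI)
      fix e :: real assume "e > 0"
      then have e: "e / 2 > 0" by simp
      obtain N1 where N1: "\<And>n. n \<ge> N1 \<Longrightarrow> alg_dist A (fst (\<sigma> n)) a < e / 2"
        using ab(1) e unfolding MA.limit_metric_sequentially o_def by blast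
      obtain N2 where N2: "\<And>n. n \<ge> N2 \<Longrightarrow> alg_dist B (snd (\<sigma> n)) b < e / 2"
        using ab(2) e unfolding MB.limit_metric_sequentially o_def by blast
      have "alg_dist ?P (\<sigma> n) (a, b) < e" if "n \<ge> max N1 N2" for n
        using N1[of n] N2[of n] that by (simp add: distP)
      then show "\<exists>N. \<forall>n\<ge>N. \<sigma> n \<in> UNIV \<and> alg_dist ?P (\<sigma> n) (a, b) < e" by blast
    qed simp
    then show "\<exists>x. limitin MP.mtopology \<sigma> x sequentially" by blast
  qed
  have sub: "nrm ?P (mul ?P x y) \<le> nrm ?P x * nrm ?P y" for x y
  proof -
    obtain a b c d where [simp]: "x = (a, b)" "y = (c, d)" by (cases x, cases y)
    have "nrm A (mul A a c + mul A a (T d) + mul A (T b) c)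
          \<le> nrm A (mul A a c) + nrm A (mul A a (T d)) + nrm A (mul A (T b) c)"
      using A.nrm_triangle[of "mul A a c + mul A a (T d)" "mul A (T b) c"]
        A.nrm_triangle[of "mul A a c" "mul A a (T d)"] by linarith
    also have "\<dots> \<le> nrm A a * nrm A c + nrm A a * nrm B d + nrm B b * nrm A c"
      by (intro add_mono order_trans[OF A.nrm_mul] mult_mono Tle order_refl A.nrm_nonneg B.nrm_nonneg)
    finally show ?thesis
      using B.nrm_mul[of b d] by (simp add: lau_product_def algebra_simps)
  qed
  show ?thesis
  proof (intro banach_algebra.intro vs banach_algebra_axioms.intro)
    show "Metric_space.mcomplete UNIV (alg_dist ?P)" by (rule comp)
    show "0 \<le> nrm ?P x" for x by (simp add: nrmP A.nrm_nonneg B.nrm_nonneg)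
  qed (fact tri hom zero sub |
      simp add: lau_product_def split_beta Tm T.add T.scale A.mul_assoc B.mul_assoc
        A.mul_add_left A.mul_add_right B.mul_add_left B.mul_add_right
        A.mul_scal_left A.mul_scal_right B.mul_scal_left B.mul_scal_right
        A.scale_right_distrib add_ac)+
qed

end

theory Submission
  imports Defs
begin

text \<open>
  A character satisfies \<open>\<psi>.a = \<psi>(a) \<psi>\<close>, so \<open>\<Delta>\<close>-weak \<open>\<phi>\<close>-amenability asks for a bounded functional
  on the dual that vanishes at \<open>\<phi>\<close> and equals 1 at every other character. This property passes to
  images under bounded surjective homomorphisms, by composition, and both \<open>(a, b) \<mapsto> a + T b\<close> and
  \<open>(a, b) \<mapsto> b\<close> are such homomorphisms on \<open>A \<times>\<^sub>T B\<close>. Conversely, every character of \<open>A \<times>\<^sub>T B\<close> is the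
  composition of a character with one of these two maps. If \<open>T\<close> has dense range, \<open>\<phi> \<circ> T\<close> is a
  character of \<open>B\<close> that determines \<open>\<phi>\<close>, so a functional for \<open>B\<close> already has the value 1 at all
  characters of \<open>A \<times>\<^sub>T B\<close> with at most two exceptions; the value at a character that comes
  from \<open>\<phi> \<in> \<Delta> A\<close> is corrected by a functional on the dual of \<open>A\<close> that is 1 at \<open>\<phi>\<close> and 0 at all other
  characters.
\<close>

section \<open>Pointwise descriptions of linear maps, functionals and characters\<close>

lemma linear_map_iff:
  assumes "banach_algebra A" "banach_algebra B"
  shows "linear_map A B f \<longleftrightarrow>
    (\<forall>x y. f (x + y) = f x + f y) \<and> (\<forall>c x. f (scal A c x) = scal B c (f x))"
  using assms by (simp add: linear_map_def Vector_Spaces.linear_iff banach_algebra_def)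

lemma vector_space_complex_alg: "vector_space (scal complex_alg)"
  by unfold_locales (simp_all add: complex_alg_def algebra_simps)

context banach_algebra
begin

lemma linear_functional_iff:
  "linear_map A complex_alg f \<longleftrightarrow>
    (\<forall>x y. f (x + y) = f x + f y) \<and> (\<forall>c x. f (scal A c x) = c * f x)"
  using vector_space_axioms vector_space_complex_alg
  by (simp add: linear_map_def Vector_Spaces.linear_iff) (simp add: complex_alg_def)

lemma dual_iff:
  "f \<in> dual A \<longleftrightarrow> (\<forall>x y. f (x + y) = f x + f y) \<and> (\<forall>c x. f (scal A c x) = c * f x) \<and>
    (\<exists>K. \<forall>x. cmod (f x) \<le> K * nrm A x)"
  unfolding dual_def bounded_map_def by (simp add: linear_functional_iff) (simp add: complex_alg_def)

lemma characters_iff: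
  "\<phi> \<in> \<Delta> A \<longleftrightarrow> (\<forall>x y. \<phi> (x + y) = \<phi> x + \<phi> y) \<and> (\<forall>c x. \<phi> (scal A c x) = c * \<phi> x) \<and>
    (\<forall>x y. \<phi> (mul A x y) = \<phi> x * \<phi> y) \<and> \<phi> \<noteq> (\<lambda>_. 0)"
  by (simp add: characters_def linear_functional_iff multiplicative_map_def)
    (simp add: complex_alg_def)

lemma nrm_zero [simp]: "nrm A 0 = 0"
  by (simp add: nrm_eq_0_iff)

lemma zero_in_dual: "(\<lambda>_. 0) \<in> dual A"
  by (auto simp: dual_iff intro: exI[of _ 0])

text \<open>If \<open>\<phi> z = 1\<close> and \<open>nrm A z < 1\<close>, the contraction \<open>y \<mapsto> z + z y\<close> has a fixed point, at which
  \<open>\<phi> y = 1 + \<phi> y\<close>.\<close>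

lemma character_le_nrm:
  assumes "\<phi> \<in> \<Delta> A"
  shows "cmod (\<phi> x) \<le> nrm A x"
proof (rule ccontr)
  assume "\<not> ?thesis"
  then have less: "nrm A x < cmod (\<phi> x)" by simp
  then have nz: "cmod (\<phi> x) > 0" using nrm_nonneg[of x] by linarith
  define z where "z = scal A (1 / \<phi> x) x"
  have z1: "\<phi> z = 1" using assms nz by (auto simp: z_def characters_iff)
  have zn: "nrm A z < 1" using less nz by (simp add: z_def nrm_scal norm_divide)
  interpret M: Metric_space UNIV "alg_dist A" by (rule metric)
  have "alg_dist A (z + mul A z u) (z + mul A z v) \<le> nrm A z * alg_dist A u v" for u v
  proof -
    have "mul A z (u - v) + mul A z v = mul A z u" by (metis mul_add_right diff_add_cancel)
    then have "mul A z u - mul A z v = mul A z (u - v)" by (simp add: algebra_simps)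
    then show ?thesis using nrm_mul[of z "u - v"] by (simp add: alg_dist_def)
  qed
  then obtain y where "z + mul A z y = y"
    using M.Banach_fixedpoint_thm[OF complete _ _ zn, of "\<lambda>u. z + mul A z u"] by auto
  then have "\<phi> y = \<phi> z + \<phi> z * \<phi> y" using assms by (metis characters_iff)
  then show False using z1 by simp
qed

lemma character_in_dual: "\<phi> \<in> \<Delta> A \<Longrightarrow> \<phi> \<in> dual A"
  using character_le_nrm[of \<phi>] by (auto simp: characters_iff dual_iff intro!: exI[of _ 1])

text \<open>Characters lie in \<open>dual A\<close>, where \<open>m\<close> is homogeneous, so
  \<open>m(\<psi>.a) = \<psi>(a) m(\<psi>)\<close>. Evaluation at some \<open>a\<close> with
  \<open>\<psi> a \<noteq> 0\<close> then removes \<open>a\<close> from the condition.\<close>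

lemma delta_weak_amenable_at_iff:
  "delta_weak_amenable_at A \<phi> \<longleftrightarrow> (\<exists>m\<in>bidual A. m \<phi> = 0 \<and> (\<forall>\<psi>\<in>\<Delta> A - {\<phi>}. m \<psi> = 1))"
proof -
  have eq: "(\<forall>a. m (dual_act A \<psi> a) = \<psi> a) \<longleftrightarrow> m \<psi> = 1"
    if m: "m \<in> bidual A" and \<psi>: "\<psi> \<in> \<Delta> A" for m \<psi>
  proof -
    have "dual_act A \<psi> a = (\<lambda>x. \<psi> a * \<psi> x)" for a
      using \<psi> by (simp add: dual_act_def characters_iff)
    then have "m (dual_act A \<psi> a) = \<psi> a * m \<psi>" for a
      using m character_in_dual[OF \<psi>] by (simp add: bidual_def)
    moreover obtain a where "\<psi> a \<noteq> 0" using \<psi> by (auto simp: characters_iff fun_eq_iff)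
    ultimately show ?thesis by auto
  qed
  have "(\<forall>a. \<forall>\<psi>\<in>\<Delta> A - {\<phi>}. m (dual_act A \<psi> a) = \<psi> a) \<longleftrightarrow> (\<forall>\<psi>\<in>\<Delta> A - {\<phi>}. m \<psi> = 1)"
    if "m \<in> bidual A" for m
  proof -
    have "(\<forall>a. \<forall>\<psi>\<in>\<Delta> A - {\<phi>}. m (dual_act A \<psi> a) = \<psi> a) \<longleftrightarrow>
        (\<forall>\<psi>\<in>\<Delta> A - {\<phi>}. \<forall>a. m (dual_act A \<psi> a) = \<psi> a)" by blast
    also have "\<dots> \<longleftrightarrow> (\<forall>\<psi>\<in>\<Delta> A - {\<phi>}. m \<psi> = 1)" by (rule ball_cong) (simp_all add: eq[OF that])
    finally show ?thesis .
  qed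
  then show ?thesis unfolding delta_weak_amenable_at_def by (simp cong: bex_cong)
qed

section \<open>Norm estimates on the dual and the bidual\<close>

lemma cmod_le_op_norm:
  assumes "f \<in> dual A" "nrm A x \<le> 1"
  shows "cmod (f x) \<le> op_norm A complex_alg f"
proof -
  obtain K where K: "\<And>x. cmod (f x) \<le> K * nrm A x" using assms(1) unfolding dual_iff by blast
  \<comment> \<open>The sign of \<open>K\<close> is unknown, so \<open>\<bar>K\<bar>\<close> serves
    as the upper bound that makes the supremum in \<open>op_norm\<close> meaningful.\<close>
  have "cmod (f y) \<le> \<bar>K\<bar>" if "nrm A y \<le> 1" for y
  proof -
    have "K * nrm A y \<le> \<bar>K\<bar> * 1"
      using that nrm_nonneg[of y] by (intro mult_mono) auto
    then show ?thesis using K[of y] by simp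
  qed
  then have "bdd_above ((\<lambda>y. cmod (f y)) ` {y. nrm A y \<le> 1})" by (auto intro!: bdd_aboveI2)
  then show ?thesis
    unfolding op_norm_def using assms(2) by (auto simp: complex_alg_def intro!: cSUP_upper)
qed

lemma op_norm_nonneg: "f \<in> dual A \<Longrightarrow> 0 \<le> op_norm A complex_alg f"
  using cmod_le_op_norm[of f 0] norm_ge_zero[of "f 0"] by (simp del: norm_ge_zero)

lemma cmod_le_op_norm_mult:
  assumes "f \<in> dual A"
  shows "cmod (f x) \<le> op_norm A complex_alg f * nrm A x"
proof (cases "x = 0")
  case True
  moreover have "f (scal A 0 0) = 0 * f 0" using assms unfolding dual_iff by blast
  ultimately show ?thesis by simp
next
  case False
  then have pos: "nrm A x > 0" using nrm_nonneg[of x] nrm_eq_0_iff[of x] by simp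
  then have "cmod (f (scal A (of_real (1 / nrm A x)) x)) \<le> op_norm A complex_alg f"
    by (intro cmod_le_op_norm assms) (simp add: nrm_scal norm_divide)
  moreover have "f (scal A c x) = c * f x" for c using assms by (simp add: dual_iff)
  ultimately show ?thesis using pos by (simp add: norm_mult norm_divide field_simps)
qed

lemma op_norm_le:
  assumes "\<And>x. nrm A x \<le> 1 \<Longrightarrow> cmod (f x) \<le> C"
  shows "op_norm A complex_alg f \<le> C"
proof -
  have "{x. nrm A x \<le> 1} \<noteq> {}" using nrm_zero by (metis (mono_tags) empty_iff mem_Collect_eq zero_le_one)
  then show ?thesis unfolding op_norm_def
    using assms by (intro cSUP_least) (auto simp: complex_alg_def)
qed

lemma bidual_bound:
  assumes "m \<in> bidual A"
  obtains K where "K \<ge> 0" "\<And>f. f \<in> dual A \<Longrightarrow> cmod (m f) \<le> K * op_norm A complex_alg f"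
proof -
  obtain K where K: "\<And>f. f \<in> dual A \<Longrightarrow> cmod (m f) \<le> K * op_norm A complex_alg f"
    using assms unfolding bidual_def by blast
  have "cmod (m f) \<le> \<bar>K\<bar> * op_norm A complex_alg f" if "f \<in> dual A" for f
    using K[OF that] mult_right_mono[OF abs_ge_self op_norm_nonneg[OF that], of K] by linarith
  then show ?thesis using that[of "\<bar>K\<bar>"] by simp
qed

text \<open>Serves to form differences of mean-like functionals and to glue functionals from
  \<open>A\<close> and \<open>B\<close> into one on the product.\<close>

lemma bidual_add_scaled:
  assumes "m \<in> bidual A" "n \<in> bidual A"
  shows "(\<lambda>f. m f + c * n f) \<in> bidual A"
proof -
  obtain K where K: "\<And>f. f \<in> dual A \<Longrightarrow> cmod (m f) \<le> K * op_norm A complex_alg f"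
    using bidual_bound[OF assms(1)] by blast
  obtain L where L: "\<And>f. f \<in> dual A \<Longrightarrow> cmod (n f) \<le> L * op_norm A complex_alg f"
    using bidual_bound[OF assms(2)] by blast
  have "cmod (m f + c * n f) \<le> (K + cmod c * L) * op_norm A complex_alg f" if "f \<in> dual A" for f
  proof -
    have "cmod (m f + c * n f) \<le> cmod (m f) + cmod c * cmod (n f)"
      by (metis norm_mult norm_triangle_ineq)
    also have "\<dots> \<le> K * op_norm A complex_alg f + cmod c * (L * op_norm A complex_alg f)"
      by (intro add_mono mult_left_mono K L that) simp
    finally show ?thesis by (simp add: algebra_simps)
  qed
  then have "\<exists>K. \<forall>f\<in>dual A. cmod (m f + c * n f) \<le> K * op_norm A complex_alg f" by blast
  then show ?thesis using assms by (simp add: bidual_def algebra_simps)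
qed

text \<open>Homogeneity with scalar 0, applied at the zero functional, which lies in
  \<open>dual A\<close>.\<close>

lemma bidual_zero:
  assumes "m \<in> bidual A"
  shows "m (\<lambda>_. 0) = 0"
proof -
  have "\<forall>c. \<forall>f\<in>dual A. m (\<lambda>x. c * f x) = c * m f"
    using assms by (simp add: bidual_def)
  from this[rule_format, OF zero_in_dual, of 0]
  show ?thesis by simp
qed

text \<open>Amenability at the zero functional gives \<open>m\<close> with value 1 at every
  character; amenability at \<open>\<phi>\<close> gives \<open>k\<close> with the same values except
  0 at \<open>\<phi>\<close>. The difference \<open>m - k\<close> is the indicator of
  \<open>\<phi>\<close> on \<open>\<Delta> A\<close>.\<close>

lemma character_separator:
  assumes "delta_weak_character_amenable A" "\<phi> \<in> \<Delta> A"
  obtains n where "n \<in> bidual A" "n \<phi> = 1" "\<And>\<psi>. \<psi> \<in> \<Delta> A \<Longrightarrow> \<psi> \<noteq> \<phi> \<Longrightarrow> n \<psi> = 0"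
proof -
  have zero: "(\<lambda>_. 0) \<notin> \<Delta> A" by (simp add: characters_iff)
  obtain m where m: "m \<in> bidual A" "\<forall>\<psi>\<in>\<Delta> A. m \<psi> = 1"
    using assms(1) zero by (auto simp: delta_weak_character_amenable_def delta_weak_amenable_at_iff)
  obtain k where k: "k \<in> bidual A" "k \<phi> = 0" "\<forall>\<psi>\<in>\<Delta> A - {\<phi>}. k \<psi> = 1"
    using assms by (auto simp: delta_weak_character_amenable_def delta_weak_amenable_at_iff)
  show ?thesis
    by (rule that[of "\<lambda>f. m f + (- 1) * k f"])
      (use m k assms(2) bidual_add_scaled[of m k "-1"] in auto)
qed

lemma dual_eq_on_dense:
  assumes f: "f \<in> dual A" and g: "g \<in> dual A" and S: "norm_dense A S"
    and eq: "\<And>x. x \<in> S \<Longrightarrow> f x = g x"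
  shows "f = g"
proof
  fix x
  interpret M: Metric_space UNIV "alg_dist A" by (rule metric)
  obtain K where K: "K \<ge> 0" "\<And>x. cmod (f x) \<le> K * nrm A x"
    using f cmod_le_op_norm_mult op_norm_nonneg by blast
  obtain L where L: "L \<ge> 0" "\<And>x. cmod (g x) \<le> L * nrm A x"
    using g cmod_le_op_norm_mult op_norm_nonneg by blast
  have sub: "h (x - y) = h x - h y" if "h \<in> dual A" for h y
    using that by (metis dual_iff add_diff_cancel_right' diff_add_cancel)
  have "cmod (f x - g x) < e" if e: "e > 0" for e
  proof -
    have "x \<in> M.mtopology closure_of S" using S by (simp add: norm_dense_def)
    \<comment> \<open>The summand 1 keeps the denominator positive when
      \<open>K = L = 0\<close>.\<close>
    moreover have "e / (K + L + 1) > 0" using e K L by simp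
    ultimately obtain y where y: "y \<in> S" "nrm A (x - y) < e / (K + L + 1)"
      by (auto simp: M.metric_closure_of alg_dist_def)
    have "cmod (f x - g x) = cmod (f (x - y) - g (x - y))"
      using eq[OF y(1)] f g by (simp add: sub)
    also have "\<dots> \<le> K * nrm A (x - y) + L * nrm A (x - y)"
      using norm_triangle_ineq4[of "f (x - y)" "g (x - y)"] K(2)[of "x - y"] L(2)[of "x - y"]
      by linarith
    also have "\<dots> \<le> (K + L + 1) * nrm A (x - y)"
      using nrm_nonneg[of "x - y"] by (simp add: algebra_simps)
    also have "\<dots> < e" using y(2) K(1) L(1) by (simp add: field_simps)
    finally show ?thesis .
  qed
  then show "f x = g x" by (metis eq_iff_diff_eq_0 less_irrefl zero_less_norm_iff)
qed

end

section \<open>Transport of functionals and amenability along bounded maps\<close>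

lemma bounded_map_bound:
  assumes "banach_algebra A" "bounded_map A B S"
  obtains K where "K \<ge> 0" "\<And>x. nrm B (S x) \<le> K * nrm A x"
proof -
  interpret banach_algebra A by fact
  obtain K where K: "\<And>x. nrm B (S x) \<le> K * nrm A x" using assms(2) by (auto simp: bounded_map_def)
  have "nrm B (S x) \<le> \<bar>K\<bar> * nrm A x" for x
    using K[of x] mult_right_mono[OF abs_ge_self nrm_nonneg[of x], of K] by linarith
  then show ?thesis using that[of "\<bar>K\<bar>"] by simp
qed

lemma dual_comp:
  assumes "banach_algebra A" "banach_algebra B" "linear_map A B S" "bounded_map A B S" "f \<in> dual B"
  shows "f \<circ> S \<in> dual A"
proof -
  interpret A: banach_algebra A by fact
  interpret B: banach_algebra B by fact
  obtain K where K: "\<And>x. nrm B (S x) \<le> K * nrm A x" using assms(4) by (auto simp: bounded_map_def)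
  have "cmod (f (S x)) \<le> op_norm B complex_alg f * K * nrm A x" for x
    using B.cmod_le_op_norm_mult[OF assms(5), of "S x"]
      mult_left_mono[OF K[of x] B.op_norm_nonneg[OF assms(5)]] by (simp add: mult.assoc)
  then show ?thesis
    using assms(3,5) by (auto simp: A.dual_iff B.dual_iff linear_map_iff[OF assms(1,2)])
qed

text \<open>This is the second adjoint of \<open>S\<close> applied to \<open>m\<close>; it is
  bounded because the adjoint \<open>f \<mapsto> f \<circ> S\<close> multiplies dual norms by at
  most \<open>K\<close>.\<close>

lemma bidual_comp:
  assumes "banach_algebra A" "banach_algebra B" "linear_map A B S" "bounded_map A B S" "m \<in> bidual A"
  shows "(\<lambda>f. m (f \<circ> S)) \<in> bidual B"
proof -
  interpret A: banach_algebra A by fact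
  interpret B: banach_algebra B by fact
  have in_dual: "f \<circ> S \<in> dual A" if "f \<in> dual B" for f using dual_comp[OF assms(1-4) that] .
  obtain K where K: "K \<ge> 0" "\<And>x. nrm B (S x) \<le> K * nrm A x"
    using bounded_map_bound[OF assms(1,4)] by blast
  obtain L where L: "L \<ge> 0" "\<And>f. f \<in> dual A \<Longrightarrow> cmod (m f) \<le> L * op_norm A complex_alg f"
    using A.bidual_bound[OF assms(5)] by blast
  have bound: "cmod (m (f \<circ> S)) \<le> L * K * op_norm B complex_alg f" if f: "f \<in> dual B" for f
  proof -
    have "cmod ((f \<circ> S) x) \<le> K * op_norm B complex_alg f" if "nrm A x \<le> 1" for x
    proof -
      have "nrm B (S x) \<le> K" using K(2)[of x] mult_left_mono[OF that K(1)] by simp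
      then show ?thesis
        using B.cmod_le_op_norm_mult[OF f, of "S x"] mult_left_mono[OF _ B.op_norm_nonneg[OF f]]
        by (fastforce simp: mult.commute)
    qed
    then have "op_norm A complex_alg (f \<circ> S) \<le> K * op_norm B complex_alg f" by (rule A.op_norm_le)
    then show ?thesis using L(2)[OF in_dual[OF f]] mult_left_mono[OF _ L(1)] by (fastforce simp: mult.assoc)
  qed
  have "m ((\<lambda>x. f x + g x) \<circ> S) = m (f \<circ> S) + m (g \<circ> S)" if "f \<in> dual B" "g \<in> dual B" for f g
    using assms(5) in_dual[OF that(1)] in_dual[OF that(2)] by (simp add: bidual_def o_def)
  moreover have "m ((\<lambda>x. c * f x) \<circ> S) = c * m (f \<circ> S)" if "f \<in> dual B" for c f
    using assms(5) in_dual[OF that(1)] by (simp add: bidual_def o_def)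
  ultimately show ?thesis using bound unfolding bidual_def by blast
qed

lemma character_comp:
  assumes "banach_algebra A" "banach_algebra B" "linear_map A B S" "multiplicative_map A B S"
    and "\<phi> \<in> \<Delta> B" "\<phi> \<circ> S \<noteq> (\<lambda>_. 0)"
  shows "\<phi> \<circ> S \<in> \<Delta> A"
  using assms(3-6)
  by (simp add: banach_algebra.characters_iff[OF assms(1)] banach_algebra.characters_iff[OF assms(2)]
      linear_map_iff[OF assms(1,2)] multiplicative_map_def)

text \<open>Surjectivity makes \<open>f \<mapsto> f \<circ> S\<close> injective: pullbacks of
  characters stay nonzero, and only \<open>\<phi>\<close> is sent to the exceptional functional
  \<open>\<phi> \<circ> S\<close>. Hence the second adjoint of a functional for
  \<open>\<phi> \<circ> S\<close> works for \<open>\<phi>\<close>.\<close>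

lemma delta_weak_character_amenable_surj:
  assumes A: "banach_algebra A" and B: "banach_algebra B"
    and S: "banach_algebra_hom A B S" "surj S"
    and am: "delta_weak_character_amenable A"
  shows "delta_weak_character_amenable B"
  unfolding delta_weak_character_amenable_def
proof
  interpret A: banach_algebra A by fact
  interpret B: banach_algebra B by fact
  fix \<phi> assume \<phi>: "\<phi> \<in> \<Delta> B \<union> {\<lambda>_. 0}"
  have cancel: "f \<circ> S = g \<circ> S \<longleftrightarrow> f = g" for f g :: "'b \<Rightarrow> complex"
    using S(2) by (metis surj_fun_eq comp_def)
  have zero: "(\<lambda>_. 0) \<circ> S = (\<lambda>_. 0 :: complex)" by auto
  have pull: "\<psi> \<circ> S \<in> \<Delta> A" if "\<psi> \<in> \<Delta> B" for \<psi>
    using character_comp[OF A B _ _ that] S(1) cancel[of \<psi> "\<lambda>_. 0"] that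
    by (simp add: banach_algebra_hom_def zero B.characters_iff)
  have "\<phi> \<circ> S \<in> \<Delta> A \<union> {\<lambda>_. 0}" using \<phi> pull zero by blast
  then obtain m where m: "m \<in> bidual A" "m (\<phi> \<circ> S) = 0" "\<forall>\<psi>\<in>\<Delta> A - {\<phi> \<circ> S}. m \<psi> = 1"
    using am by (metis delta_weak_character_amenable_def A.delta_weak_amenable_at_iff)
  have "(\<lambda>f. m (f \<circ> S)) \<in> bidual B"
    using bidual_comp[OF A B _ _ m(1)] S(1) by (simp add: banach_algebra_hom_def)
  then show "delta_weak_amenable_at B \<phi>"
    unfolding B.delta_weak_amenable_at_iff
    by (rule bexI[rotated]) (use m pull cancel in auto)
qed

section \<open>Homomorphisms and characters of the product algebra\<close>

locale lau_pair = A: banach_algebra A + B: banach_algebra B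
  for A :: "'a::ab_group_add normed_alg" and B :: "'b::ab_group_add normed_alg" +
  fixes T :: "'b \<Rightarrow> 'a"
  assumes hom: "banach_algebra_hom B A T" and contr: "op_norm B A T \<le> 1"
begin

abbreviation "P \<equiv> A \<times>\<^bsub>T\<^esub> B"

abbreviation sum_map :: "'a \<times> 'b \<Rightarrow> 'a" where
  "sum_map \<equiv> \<lambda>(a, b). a + T b"

sublocale P: banach_algebra P
  by (intro banach_algebra_lau_product hom contr A.banach_algebra_axioms B.banach_algebra_axioms)

lemma P_simps:
  "scal P c (a, b) = (scal A c a, scal B c b)"
  "mul P (a, b) (a', b') = (mul A a a' + mul A a (T b') + mul A (T b) a', mul B b b')"
  "nrm P (a, b) = nrm A a + nrm B b"
  by (simp_all add: lau_product_def)

lemmas lin =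
  linear_map_iff[OF P.banach_algebra_axioms A.banach_algebra_axioms]
  linear_map_iff[OF P.banach_algebra_axioms B.banach_algebra_axioms]
  linear_map_iff[OF A.banach_algebra_axioms P.banach_algebra_axioms]
  linear_map_iff[OF B.banach_algebra_axioms P.banach_algebra_axioms]
  linear_map_iff[OF B.banach_algebra_axioms A.banach_algebra_axioms]

lemma T_simps:
  "T (x + y) = T x + T y" "T (scal B c x) = scal A c (T x)" "T (mul B x y) = mul A (T x) (T y)"
  "T 0 = 0"
proof -
  show add: "T (x + y) = T x + T y" for x y
    using hom by (simp add: banach_algebra_hom_def lin)
  show "T (scal B c x) = scal A c (T x)" "T (mul B x y) = mul A (T x) (T y)"
    using hom by (simp_all add: banach_algebra_hom_def multiplicative_map_def lin)
  show "T 0 = 0" using add[of 0 0] by simp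
qed

text \<open>Expanding \<open>(a + T b)(a' + T b')\<close> gives the three terms in the first
  component of the product, plus \<open>T(b b')\<close>.\<close>

lemma sum_map_hom: "banach_algebra_hom P A sum_map"
proof -
  obtain K where K: "K \<ge> 0" "\<And>x. nrm A (T x) \<le> K * nrm B x"
    using bounded_map_bound[OF B.banach_algebra_axioms] hom by (metis banach_algebra_hom_def)
  have "nrm A (a + T b) \<le> (1 + K) * (nrm A a + nrm B b)" for a b
    using A.nrm_triangle[of a "T b"] K(2)[of b] mult_nonneg_nonneg[OF K(1) A.nrm_nonneg[of a]]
      B.nrm_nonneg[of b] by (simp add: algebra_simps)
  then have "bounded_map P A sum_map"
    unfolding bounded_map_def by (intro exI[of _ "1 + K"]) (auto simp: P_simps)
  then show ?thesis
    by (auto simp: banach_algebra_hom_def lin multiplicative_map_def P_simps T_simps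
        A.mul_add_left A.mul_add_right A.scale_right_distrib)
qed

lemma snd_hom: "banach_algebra_hom P B snd"
  by (auto simp: banach_algebra_hom_def lin multiplicative_map_def bounded_map_def P_simps
      A.nrm_nonneg intro!: exI[of _ 1])

lemma surj_sum_map: "surj sum_map"
  by (rule surjI[of _ "\<lambda>a. (a, 0)"]) (simp add: T_simps)

text \<open>The two embeddings carry bidual elements of \<open>A\<close> and \<open>B\<close> into
  the bidual of \<open>P\<close>.\<close>

lemma inl_bounded_linear: "linear_map A P (\<lambda>a. (a, 0))" "bounded_map A P (\<lambda>a. (a, 0))"
  by (auto simp: lin bounded_map_def P_simps intro!: exI[of _ 1])

lemma inr_bounded_linear: "linear_map B P (\<lambda>b. (0, b))" "bounded_map B P (\<lambda>b. (0, b))"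
  by (auto simp: lin bounded_map_def P_simps intro!: exI[of _ 1])

text \<open>The restriction \<open>\<phi>\<close> of \<open>\<theta>\<close> to \<open>A\<close> satisfies \<open>\<phi>(a) \<theta>(0, b) = \<phi>(a) \<phi>(T b)\<close>, which forces
  \<open>\<theta>(0, b) = \<phi>(T b)\<close> unless \<open>\<phi> = 0\<close>.\<close>

lemma character_cases:
  assumes "\<theta> \<in> \<Delta> P"
  obtains \<phi> where "\<phi> \<in> \<Delta> A" "\<theta> = \<phi> \<circ> sum_map"
  | \<psi> where "\<psi> \<in> \<Delta> B" "\<theta> = \<psi> \<circ> snd"
proof -
  define \<phi> where "\<phi> = (\<lambda>a. \<theta> (a, 0))"
  define \<psi> where "\<psi> = (\<lambda>b. \<theta> (0, b))"
  have \<theta>: "\<theta> (x + y) = \<theta> x + \<theta> y" "\<theta> (scal P c x) = c * \<theta> x" "\<theta> (mul P x y) = \<theta> x * \<theta> y" for x y c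
    using assms unfolding P.characters_iff by blast+
  have A0: "mul A x 0 = 0" "mul A 0 x = 0" for x
    using A.mul_add_right[of x 0 0] A.mul_add_left[of 0 0 x] by simp_all
  have B0: "mul B x 0 = 0" "mul B 0 x = 0" for x
    using B.mul_add_right[of x 0 0] B.mul_add_left[of 0 0 x] by simp_all
  have split: "\<theta> (a, b) = \<phi> a + \<psi> b" for a b
    using \<theta>(1)[of "(a, 0)" "(0, b)"] by (simp add: \<phi>_def \<psi>_def)
  have \<phi>: "\<phi> (x + y) = \<phi> x + \<phi> y" "\<phi> (scal A c x) = c * \<phi> x" "\<phi> (mul A x y) = \<phi> x * \<phi> y" for x y c
    using \<theta>(1)[of "(x, 0)" "(y, 0)"] \<theta>(2)[of c "(x, 0)"] \<theta>(3)[of "(x, 0)" "(y, 0)"]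
    by (simp_all add: \<phi>_def P_simps T_simps A0 B0)
  have \<psi>: "\<psi> (x + y) = \<psi> x + \<psi> y" "\<psi> (scal B c x) = c * \<psi> x" "\<psi> (mul B x y) = \<psi> x * \<psi> y" for x y c
    using \<theta>(1)[of "(0, x)" "(0, y)"] \<theta>(2)[of c "(0, x)"] \<theta>(3)[of "(0, x)" "(0, y)"]
    by (simp_all add: \<psi>_def P_simps T_simps A0 B0)
  \<comment> \<open>Since \<open>(a, 0)(0, b) = (a T b, 0)\<close>, multiplicativity of
    \<open>\<theta>\<close> gives two expressions for the same value.\<close>
  have mixed: "\<phi> a * \<psi> b = \<phi> a * \<phi> (T b)" for a b
    using \<theta>(3)[of "(a, 0)" "(0, b)"] \<phi>(3)[of a "T b"]
    by (simp add: P_simps T_simps A0 B0 \<phi>_def \<psi>_def)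
  show ?thesis
  proof (cases "\<phi> = (\<lambda>_. 0)")
    case True
    then have eq: "\<theta> = \<psi> \<circ> snd" using split by auto
    moreover have "\<psi> \<noteq> (\<lambda>_. 0)" using eq assms by (auto simp: P.characters_iff)
    ultimately have "\<psi> \<in> \<Delta> B" using \<psi> by (simp add: B.characters_iff)
    then show ?thesis using eq by (rule that(2))
  next
    case False
    then obtain a where "\<phi> a \<noteq> 0" by auto
    then have "\<psi> b = \<phi> (T b)" for b using mixed[of a b] by simp
    then have "\<theta> = \<phi> \<circ> sum_map" using split \<phi>(1) by auto
    moreover have "\<phi> \<in> \<Delta> A" using \<phi> False by (simp add: A.characters_iff)
    ultimately show ?thesis using that(1) by blast
  qed
qed

text \<open>Restriction to the copy of \<open>A\<close> recovers \<open>\<phi>\<close>. For a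
  character \<open>\<psi>\<close> the constant \<open>\<psi> 0\<close> is 0; it stays unevaluated
  because \<open>\<psi>\<close> is arbitrary here.\<close>

lemma comp_inl: "(\<phi> \<circ> sum_map) \<circ> (\<lambda>a. (a, 0)) = \<phi>" "(\<psi> \<circ> snd) \<circ> (\<lambda>a. (a, 0)) = (\<lambda>_. \<psi> 0)"
  by (auto simp: T_simps)

lemma comp_inr: "(\<phi> \<circ> sum_map) \<circ> (\<lambda>b. (0, b)) = \<phi> \<circ> T" "(\<psi> \<circ> snd) \<circ> (\<lambda>b. (0, b)) = \<psi>"
  by auto

text \<open>The functional \<open>k\<close> applies \<open>m\<close> to the restriction to
  \<open>B\<close> and \<open>c n\<close> to the restriction to \<open>A\<close>. At
  \<open>\<phi> \<circ> sum_map\<close> it is \<open>m(\<phi> \<circ> T) + c n(\<phi>)\<close>; at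
  \<open>\<psi> \<circ> snd\<close> the second term vanishes. By \<open>character_cases\<close> this
  covers all of \<open>\<Delta> P\<close>.\<close>

lemma amenable_at_combine:
  assumes m: "m \<in> bidual B" and n: "n \<in> bidual A" and \<theta>0: "\<theta>0 \<in> \<Delta> P \<union> {\<lambda>_. 0}"
    and on_A: "\<And>\<phi>. \<phi> \<in> \<Delta> A \<Longrightarrow> m (\<phi> \<circ> T) + c * n \<phi> = (if \<phi> \<circ> sum_map = \<theta>0 then 0 else 1)"
    and on_B: "\<And>\<psi>. \<psi> \<in> \<Delta> B \<Longrightarrow> m \<psi> = (if \<psi> \<circ> snd = \<theta>0 then 0 else 1)"
  shows "delta_weak_amenable_at P \<theta>0"
proof -
  define k where "k = (\<lambda>f. m (f \<circ> (\<lambda>b. (0, b))) + c * n (f \<circ> (\<lambda>a. (a, 0))))"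
  have k: "k \<in> bidual P"
    unfolding k_def
    by (intro P.bidual_add_scaled bidual_comp[OF B.banach_algebra_axioms P.banach_algebra_axioms]
        bidual_comp[OF A.banach_algebra_axioms P.banach_algebra_axioms] inl_bounded_linear
        inr_bounded_linear m n)
  have val: "k \<theta> = (if \<theta> = \<theta>0 then 0 else 1)" if "\<theta> \<in> \<Delta> P" for \<theta>
    using that
  proof (cases rule: character_cases)
    case (1 \<phi>)
    then show ?thesis using on_A[OF 1(1)] by (simp only: k_def comp_inl comp_inr)
  next
    case (2 \<psi>)
    have "\<psi> 0 = 0" using 2(1) B.characters_iff[of \<psi>] by (metis add_cancel_right_right)
    then show ?thesis
      using 2 on_B[OF 2(1)] A.bidual_zero[OF n] by (simp only: k_def comp_inl comp_inr) simp
  qed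
  have "k \<theta>0 = 0" using \<theta>0 val P.bidual_zero[OF k] by auto
  then show ?thesis unfolding P.delta_weak_amenable_at_iff using k val by (intro bexI[of _ k]) auto
qed

lemma amenable_lau_product:
  assumes dense: "norm_dense A (range T)"
    and amA: "delta_weak_character_amenable A" and amB: "delta_weak_character_amenable B"
  shows "delta_weak_character_amenable P"
  unfolding delta_weak_character_amenable_def
proof
  fix \<theta>0 assume \<theta>0: "\<theta>0 \<in> \<Delta> P \<union> {\<lambda>_. 0}"
  \<comment> \<open>Density enters here: bounded functionals that agree on the range of
    \<open>T\<close> coincide. It makes \<open>\<phi> \<circ> T\<close> nonzero for a character
    \<open>\<phi>\<close> and \<open>\<phi> \<mapsto> \<phi> \<circ> T\<close> injective.\<close>
  have cancel: "f = g" if "f \<in> dual A" "g \<in> dual A" "f \<circ> T = g \<circ> T" for f g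
    using A.dual_eq_on_dense[OF that(1,2) dense] that(3) by (auto simp: fun_eq_iff)
  have pull: "\<phi> \<circ> T \<in> \<Delta> B" if "\<phi> \<in> \<Delta> A" for \<phi>
  proof (rule character_comp[OF B.banach_algebra_axioms A.banach_algebra_axioms _ _ that])
    show "\<phi> \<circ> T \<noteq> (\<lambda>_. 0)"
      using cancel[OF A.character_in_dual[OF that] A.zero_in_dual] that
      by (auto simp: A.characters_iff o_def)
  qed (use hom in \<open>auto simp: banach_algebra_hom_def\<close>)
  have zeroB: "(\<lambda>_. 0) \<notin> \<Delta> B" by (simp add: B.characters_iff)
  have inj_sum: "\<phi> \<circ> sum_map = \<phi>' \<circ> sum_map \<longleftrightarrow> \<phi> = \<phi>'" for \<phi> \<phi>' :: "'a \<Rightarrow> complex"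
    by (metis comp_inl(1))
  have inj_snd: "\<psi> \<circ> snd = \<psi>' \<circ> (snd :: 'a \<times> 'b \<Rightarrow> 'b) \<longleftrightarrow> \<psi> = \<psi>'" for \<psi> \<psi>' :: "'b \<Rightarrow> complex"
    by (metis comp_inr(2))
  \<comment> \<open>Restricted to \<open>A\<close>, the left side is \<open>\<phi>\<close> and the
    right side is constant. As \<open>\<psi>\<close> is arbitrary, the case
    \<open>\<psi> = 0\<close> shows that \<open>\<phi> \<circ> sum_map\<close> is nonzero.\<close>
  have neq: "\<phi> \<circ> sum_map \<noteq> \<psi> \<circ> snd" if "\<phi> \<in> \<Delta> A" for \<phi> \<psi>
  proof
    assume "\<phi> \<circ> sum_map = \<psi> \<circ> snd"
    then have "\<phi> = (\<lambda>_. \<psi> 0)" by (metis comp_inl)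
    moreover have "\<phi> 0 = 0" using that A.characters_iff[of \<phi>] by (metis add_cancel_right_right)
    ultimately show False using that by (auto simp: A.characters_iff)
  qed
  obtain m where m: "m \<in> bidual B" "\<And>\<psi>. \<psi> \<in> \<Delta> B \<Longrightarrow> m \<psi> = 1"
    using amB zeroB by (auto simp: delta_weak_character_amenable_def B.delta_weak_amenable_at_iff)
  \<comment> \<open>Any bidual element will do: \<open>n0\<close> is only used with coefficient
    0.\<close>
  obtain n0 where n0: "n0 \<in> bidual A"
    using amA by (auto simp: delta_weak_character_amenable_def A.delta_weak_amenable_at_iff)
  consider "\<theta>0 = (\<lambda>_. 0)" | "\<theta>0 \<in> \<Delta> P" using \<theta>0 by auto
  then show "delta_weak_amenable_at P \<theta>0"
  proof cases
    case 1
    have "\<phi> \<circ> sum_map \<noteq> \<theta>0" if "\<phi> \<in> \<Delta> A" for \<phi>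
      using neq[OF that, of "\<lambda>_. 0"] 1 by (simp add: o_def)
    moreover have "\<psi> \<circ> snd \<noteq> \<theta>0" if "\<psi> \<in> \<Delta> B" for \<psi>
      using inj_snd[of \<psi> "\<lambda>_. 0"] that zeroB 1 by (auto simp: o_def)
    ultimately show ?thesis
      using m pull by (intro amenable_at_combine[OF m(1) n0 \<theta>0, of 0]) auto
  next
    case 2
    then show ?thesis
    proof (cases rule: character_cases)
      case (1 \<phi>)
      obtain n where n: "n \<in> bidual A" "n \<phi> = 1" "\<And>\<phi>'. \<phi>' \<in> \<Delta> A \<Longrightarrow> \<phi>' \<noteq> \<phi> \<Longrightarrow> n \<phi>' = 0"
        using A.character_separator[OF amA 1(1)] by blast
      show ?thesis
      \<comment> \<open>\<open>m\<close> has the value 1 at every \<open>\<phi>' \<circ> T\<close>;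
        subtracting the indicator \<open>n\<close> of \<open>\<phi>\<close> lowers the value to 0
        exactly at \<open>\<theta>0\<close>.\<close>
      proof (rule amenable_at_combine[OF m(1) n(1) \<theta>0, of "-1"])
        show "m (\<phi>' \<circ> T) + - 1 * n \<phi>' = (if \<phi>' \<circ> sum_map = \<theta>0 then 0 else 1)" if "\<phi>' \<in> \<Delta> A" for \<phi>'
          using m(2)[OF pull[OF that]] n that unfolding 1(2) inj_sum by auto
        show "m \<psi> = (if \<psi> \<circ> snd = \<theta>0 then 0 else 1)" if "\<psi> \<in> \<Delta> B" for \<psi>
          using m(2)[OF that] neq[OF 1(1), of \<psi>] unfolding 1(2) by auto
      qed
    next
      case (2 \<psi>)
      obtain k where k: "k \<in> bidual B" "k \<psi> = 0" "\<And>\<psi>'. \<psi>' \<in> \<Delta> B \<Longrightarrow> \<psi>' \<noteq> \<psi> \<Longrightarrow> k \<psi>' = 1"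
        using amB 2(1)
        by (auto simp: delta_weak_character_amenable_def B.delta_weak_amenable_at_iff)
      \<comment> \<open>\<open>k\<close> vanishes at \<open>\<psi>\<close>, hence also at
        \<open>\<phi> \<circ> T\<close> when this equals \<open>\<psi>\<close>, although
        \<open>\<phi> \<circ> sum_map\<close> needs the value 1. By injectivity at most one such
        \<open>\<phi>\<close> exists, and its indicator supplies the missing 1; without such a
        \<open>\<phi>\<close> the coefficient is 0.\<close>
      obtain n c where n: "n \<in> bidual A"
        "\<And>\<phi>. \<phi> \<in> \<Delta> A \<Longrightarrow> c * n \<phi> = (if \<phi> \<circ> T = \<psi> then 1 else 0)"
      proof (cases "\<exists>\<phi>\<in>\<Delta> A. \<phi> \<circ> T = \<psi>")
        case True
        then obtain \<phi> where \<phi>: "\<phi> \<in> \<Delta> A" "\<phi> \<circ> T = \<psi>" by blast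
        obtain n where n: "n \<in> bidual A" "n \<phi> = 1" "\<And>\<phi>'. \<phi>' \<in> \<Delta> A \<Longrightarrow> \<phi>' \<noteq> \<phi> \<Longrightarrow> n \<phi>' = 0"
          using A.character_separator[OF amA \<phi>(1)] by blast
        have "\<phi>' \<circ> T = \<psi> \<longleftrightarrow> \<phi>' = \<phi>" if "\<phi>' \<in> \<Delta> A" for \<phi>'
          using cancel[of \<phi>' \<phi>] that \<phi> A.character_in_dual by auto
        then show ?thesis using n by (intro that[of n 1]) auto
      next
        case False
        then show ?thesis using n0 by (intro that[of n0 0]) auto
      qed
      show ?thesis
      proof (rule amenable_at_combine[OF k(1) n(1) \<theta>0, of c])
        show "k (\<phi> \<circ> T) + c * n \<phi> = (if \<phi> \<circ> sum_map = \<theta>0 then 0 else 1)" if "\<phi> \<in> \<Delta> A" for \<phi>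
          using k(2) k(3)[OF pull[OF that]] n(2)[OF that] neq[OF that, of \<psi>] unfolding 2(2) by auto
        show "k \<psi>' = (if \<psi>' \<circ> snd = \<theta>0 then 0 else 1)" if "\<psi>' \<in> \<Delta> B" for \<psi>'
          using k(2,3) that unfolding 2(2) inj_snd by auto
      qed
    qed
  qed
qed

end

theorem theorem3p2:
  fixes A :: "'a::ab_group_add normed_alg"
    and B :: "'b::ab_group_add normed_alg"
    and T :: "'b \<Rightarrow> 'a"
  assumes "banach_algebra A" and "banach_algebra B"
    and "banach_algebra_hom B A T" and "op_norm B A T \<le> 1"
  shows "(delta_weak_character_amenable (A \<times>\<^bsub>T\<^esub> B) \<longrightarrow>
            delta_weak_character_amenable A \<and> delta_weak_character_amenable B) \<and>
         (norm_dense A (range T) \<longrightarrow>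
            delta_weak_character_amenable A \<and> delta_weak_character_amenable B \<longrightarrow>
            delta_weak_character_amenable (A \<times>\<^bsub>T\<^esub> B))"
proof -
  interpret lau_pair A B T
    using assms by (simp add: lau_pair_def lau_pair_axioms_def)
  show ?thesis
    using delta_weak_character_amenable_surj[OF P.banach_algebra_axioms assms(1) sum_map_hom surj_sum_map]
      delta_weak_character_amenable_surj[OF P.banach_algebra_axioms assms(2) snd_hom range_snd]
      amenable_lau_product
    by blast
qed

end
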